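(* (Cayley–Hamilton theorem.) Let $M$ be an $n\times n$ $q$-Manin matrix over $\mathfrak R$. Then $$\sum_{m=0}^n(-1)^m\,\mathfrak e_m\,M^{[n-m]}=0,$$ where $\mathfrak e_m$ are the sums of principal $q$-minors of $M$ and $M^{[k]}$ are the $q$-powers of $M$.
   Context: Let $q$ be a nonzero complex number and $\mathfrak R$ an associative unital, not necessarily commutative, algebra over $\mathbb C$. A matrix $M=(M_{ij})$ over $\mathfrak R$ is called $q$-Manin if $M_{ij}M_{kj}=q^{-1}M_{kj}M_{ij}$ for all $j$ and all $i<k$, and $M_{ij}M_{kl}-M_{kl}M_{ij}=q^{-1}M_{kj}M_{il}-q\,M_{il}M_{kj}$ for all $i<k$, $j<l$. The $q$-determinant of an $m\times m$ matrix $N$ is $\det_q N=\sum_{\tau\in\mathfrak S_m}(-q)^{-\mathrm{inv}(\tau)}N_{\tau(1)1}\cdots N_{\tau(m)m}$, where $\mathrm{inv}(\tau)$ is the number of inversions. Set $\mathfrak e_0=1$ and $\mathfrak e_m=\sum_{1\le i_1<\ldots<i_m\le n}\det_q\big((M_{i_ai_b})_{1\le a,b\le m}\big)$ for $1\le m\le n$. For $n\times n$ matrices $A,B$ over $\mathfrak R$ define the $n\times n$ matrix $A*_qB$ by $(A*_qB)_{ik}=\sum_{j=1}^n q^{\mathrm{sgn}(j-i)}A_{ij}B_{jk}$, where $\mathrm{sgn}(r)=1,0,-1$ for $r>0$, $r=0$, $r<0$. The $q$-powers of $M$ are $M^{[0]}=1$ (identity matrix) and $M^{[m]}=M^{[m-1]}*_qM$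 for $m\ge1$. The product $\mathfrak e_mM^{[n-m]}$ is entrywise multiplication by $\mathfrak e_m$ from the left. *)

theory Defs
  imports
    Complex_Main
    "HOL-Combinatorics.Permutations"
    "Jordan_Normal_Form.Matrix"
    "Jordan_Normal_Form.DL_Submatrix"
begin

(* Associative unital algebras over the complex numbers, not necessarily commutative.
   The superclass is ring + monoid_mult rather than ring_1, so that the zero algebra
   is not excluded. *)
class complex_algebra_1 = ring + monoid_mult +
  fixes scaleC :: "complex \<Rightarrow> 'a \<Rightarrow> 'a" (infixr "*\<^sub>C" 75)
  assumes scaleC_add_right: "c *\<^sub>C (x + y) = c *\<^sub>C x + c *\<^sub>C y"
    and scaleC_add_left: "(c + d) *\<^sub>C x = c *\<^sub>C x + d *\<^sub>C x"
    and scaleC_scaleC: "c *\<^sub>C (d *\<^sub>C x) = (c * d) *\<^sub>C x"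
    and scaleC_one: "1 *\<^sub>C x = x"
    and mult_scaleC_left: "(c *\<^sub>C x) * y = c *\<^sub>C (x * y)"
    and mult_scaleC_right: "x * (c *\<^sub>C y) = c *\<^sub>C (x * y)"

(* Rows and columns of matrices are numbered from 0 throughout. *)

definition q_Manin :: "complex \<Rightarrow> 'a::complex_algebra_1 mat \<Rightarrow> bool" where
  "q_Manin q M \<longleftrightarrow>
     (\<forall>i k j. i < k \<and> k < dim_row M \<and> j < dim_col M \<longrightarrow>
        M $$ (i,j) * M $$ (k,j) = inverse q *\<^sub>C (M $$ (k,j) * M $$ (i,j))) \<and>
     (\<forall>i k j l. i < k \<and> k < dim_row M \<and> j < l \<and> l < dim_col M \<longrightarrow>
        M $$ (i,j) * M $$ (k,l) - M $$ (k,l) * M $$ (i,j) =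
          inverse q *\<^sub>C (M $$ (k,j) * M $$ (i,l)) - q *\<^sub>C (M $$ (i,l) * M $$ (k,j)))"

definition inversions :: "nat \<Rightarrow> (nat \<Rightarrow> nat) \<Rightarrow> nat" where
  "inversions m \<tau> = card {(a, b). a < b \<and> b < m \<and> \<tau> b < \<tau> a}"

(* The factors do not commute; they are taken in increasing order of the column index. *)
definition q_det :: "complex \<Rightarrow> 'a::complex_algebra_1 mat \<Rightarrow> 'a" where
  "q_det q N = (\<Sum>\<tau> | \<tau> permutes {0..<dim_row N}.
     ((- q) powi (- int (inversions (dim_row N) \<tau>))) *\<^sub>C
       prod_list (map (\<lambda>j. N $$ (\<tau> j, j)) [0..<dim_row N]))"

(* An increasing index sequence of length m is encoded by the set of its entries;
   submatrix enumerates that set in increasing order. *)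
definition q_minor_sum :: "complex \<Rightarrow> 'a::complex_algebra_1 mat \<Rightarrow> nat \<Rightarrow> 'a" where
  "q_minor_sum q M m =
     (if m = 0 then 1
      else (\<Sum>I | I \<subseteq> {0..<dim_row M} \<and> card I = m. q_det q (submatrix M I I)))"

definition q_mult :: "complex \<Rightarrow> 'a::complex_algebra_1 mat \<Rightarrow> 'a mat \<Rightarrow> 'a mat" where
  "q_mult q A B = mat (dim_row A) (dim_col B) (\<lambda>(i, k).
     \<Sum>j = 0..<dim_row B. (q powi sgn (int j - int i)) *\<^sub>C (A $$ (i,j) * B $$ (j,k)))"

(* The recursion multiplies by M on the right; the operation q_mult need not be associative. *)
primrec q_pow :: "complex \<Rightarrow> 'a::complex_algebra_1 mat \<Rightarrow> nat \<Rightarrow> 'a mat" where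
  "q_pow q M 0 = 1\<^sub>m (dim_row M)"
| "q_pow q M (Suc m) = q_mult q (q_pow q M m) M"

(* Sum of a family of n x n matrices. Matrices of varying dimension are not an instance of
   comm_monoid_add, so sum does not apply to them. *)
definition mat_sum :: "nat \<Rightarrow> ('b \<Rightarrow> 'a::comm_monoid_add mat) \<Rightarrow> 'b set \<Rightarrow> 'a mat" where
  "mat_sum n F S = mat n n (\<lambda>(i, k). \<Sum>s\<in>S. F s $$ (i,k))"

end

theory Submission
  imports Defs
begin

text \<open>
  The proof takes place in the \<open>q\<close>-exterior algebra over the coefficient algebra: generators
  \<open>e\<^sub>i\<close> commuting with all coefficients, with \<open>e\<^sub>i e\<^sub>i = 0\<close> and
  \<open>e\<^sub>k e\<^sub>i = - q\<^sup>-\<^sup>1 e\<^sub>i e\<^sub>k\<close> for \<open>i < k\<close>. The Manin relations say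
  exactly that the columns \<open>\<phi>\<^sub>j = \<Sum>\<^sub>i e\<^sub>i M\<^sub>i\<^sub>j\<close> satisfy the same relations as the generators
  (\<open>wedge_column_twice\<close>, \<open>wedge_columns_exchange\<close>). Writing \<open>e\<^sub>T\<close>, \<open>\<phi>\<^sub>T\<close> for the
  products over a finite set \<open>T\<close> in increasing order, it follows that \<open>\<phi>\<^sub>T \<phi>\<^sub>l\<close> is
  zero if \<open>l \<in> T\<close>, and otherwise is \<open>\<phi>\<close> of \<open>T \<union> {l}\<close> times the very scalar that
  occurs for the generators (\<open>wedge_q_minor\<close>). The coefficient of \<open>e\<^sub>I\<close> in \<open>\<phi>\<^sub>I\<close> is
  the principal \<open>q\<close>-minor on \<open>I\<close> (\<open>q_det_submatrix\<close>).

  As in the classical proof through the adjugate of \<open>t + M\<close>, matrices \<open>Y\<^sup>(\<^sup>m\<^sup>)\<close> are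
  built from the minors of size \<open>m\<close>. Let \<open>[e\<^sub>T e\<^sub>i]\<close> denote the coefficient with respect to
  \<open>e\<^sub>T e\<^sub>i\<close>; the \<open>(i,k)\<close> entry is defined by
  \<open>q\<close> to the \<open>sgn (k - i)\<close> times \<open>Y\<^sup>(\<^sup>m\<^sup>)\<^sub>i\<^sub>k\<close> \<open>= \<Sum>\<^sub>T [e\<^sub>T e\<^sub>i] \<phi>\<^sub>T e\<^sub>k\<close>, the sum being
  over the \<open>T\<close> of size \<open>m\<close> with \<open>i \<notin> T\<close>. The power of \<open>q\<close> in
  this definition is the one in the product \<open>*\<^sub>q\<close>, so the \<open>(i,l)\<close> entry of
  \<open>Y\<^sup>(\<^sup>m\<^sup>) *\<^sub>q M\<close> is \<open>\<Sum>\<^sub>T [e\<^sub>T e\<^sub>i] \<phi>\<^sub>T \<phi>\<^sub>l\<close>. The rule for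
  \<open>\<phi>\<^sub>T \<phi>\<^sub>l\<close> turns this into the recursion
  \<open>Y\<^sup>(\<^sup>m\<^sup>) *\<^sub>q M = \<e>\<^sub>m\<^sub>+\<^sub>1 1 - Y\<^sup>(\<^sup>m\<^sup>+\<^sup>1\<^sup>)\<close> (\<open>q_adjugate_step\<close>), starting from \<open>Y\<^sup>(\<^sup>0\<^sup>) = 1\<close>. Hence
  \<open>\<Sum>\<^sub>j\<^sub>\<le>\<^sub>m (-1)\<^sup>j \<e>\<^sub>j M\<^sup>[\<^sup>m\<^sup>-\<^sup>j\<^sup>] = (-1)\<^sup>m Y\<^sup>(\<^sup>m\<^sup>)\<close> for every \<open>m\<close>, and
  \<open>Y\<^sup>(\<^sup>n\<^sup>) = 0\<close> because no subset of \<open>{0..<n}\<close> of size \<open>n\<close> misses \<open>i\<close>.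
\<close>

section \<open>Multiplication in the q-exterior algebra\<close>

interpretation scaleC: vector_space "scaleC :: complex \<Rightarrow> 'a::complex_algebra_1 \<Rightarrow> 'a"
  by unfold_locales (auto simp: scaleC_add_right scaleC_add_left scaleC_scaleC scaleC_one)

text \<open>
  For \<open>k \<in> S\<close> and \<open>T = S - {k}\<close>, the scalar in \<open>e\<^sub>T e\<^sub>k = crossing q k S e\<^sub>S\<close>: moving \<open>e\<^sub>k\<close> from the right end to its place costs a factor
  \<open>- q\<^sup>-\<^sup>1\<close> for each larger index.
\<close>

definition crossing :: "complex \<Rightarrow> nat \<Rightarrow> nat set \<Rightarrow> complex" where
  "crossing q k S = inverse (- q) ^ card {s \<in> S. k < s}"

text \<open>
  An element of the \<open>q\<close>-exterior algebra is encoded by the function that sends a finite set \<open>S\<close>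
  to the coefficient of \<open>e\<^sub>S\<close>. In this encoding \<open>wedge q w v\<close> is the product
  \<open>w (\<Sum>\<^sub>i e\<^sub>i v\<^sub>i)\<close>, and right multiplication by such elements of degree one generates all products of
  columns from the unit.
\<close>

definition wedge :: "complex \<Rightarrow> (nat set \<Rightarrow> 'a::complex_algebra_1) \<Rightarrow> (nat \<Rightarrow> 'a) \<Rightarrow> nat set \<Rightarrow> 'a" where
  "wedge q w v S = (\<Sum>i\<in>S. crossing q i S *\<^sub>C (w (S - {i}) * v i))"

text \<open>
  The product of the columns of \<open>A\<close> listed in \<open>js\<close>, starting from the unit, whose only
  coefficient is \<open>1\<close> at the empty set.
\<close>

definition wedge_list :: "complex \<Rightarrow> (nat \<Rightarrow> nat \<Rightarrow> 'a::complex_algebra_1) \<Rightarrow> nat list \<Rightarrow> nat set \<Rightarrow> 'a" where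
  "wedge_list q A js = foldl (\<lambda>w j. wedge q w (\<lambda>i. A i j)) (\<lambda>S. if S = {} then 1 else 0) js"

text \<open>
  The value at \<open>I\<close> is the minor with columns \<open>J\<close> and rows \<open>I\<close>; as a function of
  the rows, \<open>q_minor q A J\<close> is the product \<open>\<phi>\<^sub>J\<close> of the columns in \<open>J\<close>.
\<close>

definition q_minor :: "complex \<Rightarrow> (nat \<Rightarrow> nat \<Rightarrow> 'a::complex_algebra_1) \<Rightarrow> nat set \<Rightarrow> nat set \<Rightarrow> 'a" where
  "q_minor q A J = wedge_list q A (sorted_list_of_set J)"

lemma crossing_nonzero: "q \<noteq> 0 \<Longrightarrow> crossing q k S \<noteq> 0"
  by (simp add: crossing_def)

lemma crossing_remove_greater:
  assumes "finite S" "k \<in> S" "i < k"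
  shows "crossing q i S = inverse (- q) * crossing q i (S - {k})"
proof -
  have "{s \<in> S. i < s} = insert k {s \<in> S - {k}. i < s}" using assms by auto
  then show ?thesis using assms by (simp add: crossing_def)
qed

lemma crossing_remove_less:
  assumes "i < k"
  shows "crossing q k (S - {i}) = crossing q k S"
proof -
  have "{s \<in> S - {i}. k < s} = {s \<in> S. k < s}" using assms by auto
  then show ?thesis by (simp add: crossing_def)
qed

lemma crossing_remove_self: "crossing q k (S - {k}) = crossing q k S"
proof -
  have "{s \<in> S - {k}. k < s} = {s \<in> S. k < s}" by auto
  then show ?thesis by (simp add: crossing_def)
qed

lemma wedge_scaleC: "wedge q (\<lambda>S. c *\<^sub>C w S) v = (\<lambda>S. c *\<^sub>C wedge q w v S)"
  by (simp add: wedge_def fun_eq_iff scaleC.scale_sum_right mult_scaleC_left scaleC_scaleC mult.commute)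

lemma wedge_zero: "wedge q (\<lambda>S. 0) v = (\<lambda>S. 0)"
  by (simp add: wedge_def fun_eq_iff)

lemma sum_off_diagonal:
  fixes g :: "nat \<Rightarrow> nat \<Rightarrow> 'b::comm_monoid_add"
  assumes "finite S"
  shows "(\<Sum>i\<in>S. \<Sum>k\<in>S - {i}. g i k) = (\<Sum>(i,k) | i \<in> S \<and> k \<in> S \<and> i < k. g i k + g k i)"
proof -
  let ?L = "{(i,k). i \<in> S \<and> k \<in> S \<and> i < k}" and ?G = "{(i,k). i \<in> S \<and> k \<in> S \<and> k < i}"
  have fin: "finite ?L" "finite ?G"
    using assms by (auto intro: finite_subset[of _ "S \<times> S"])
  have "(\<Sum>i\<in>S. \<Sum>k\<in>S - {i}. g i k) = (\<Sum>(i,k)\<in>Sigma S (\<lambda>i. S - {i}). g i k)"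
    using assms by (simp add: sum.Sigma)
  also have "Sigma S (\<lambda>i. S - {i}) = ?L \<union> ?G" by auto
  also have "(\<Sum>(i,k)\<in>?L \<union> ?G. g i k) = (\<Sum>(i,k)\<in>?L. g i k) + (\<Sum>(i,k)\<in>?G. g i k)"
    using fin by (intro sum.union_disjoint) auto
  also have "(\<Sum>(i,k)\<in>?G. g i k) = (\<Sum>(i,k)\<in>?L. g k i)"
    by (rule sum.reindex_bij_witness[of _ prod.swap prod.swap]) auto
  finally show ?thesis by (simp add: sum.distrib case_prod_unfold)
qed

text \<open>
  Multiplying \<open>w\<close> by \<open>\<Sum>\<^sub>i e\<^sub>i u\<^sub>i\<close> and then by \<open>\<Sum>\<^sub>k e\<^sub>k v\<^sub>k\<close> removes two indices from
  \<open>S\<close>, in either order. Collecting both orders of a pair \<open>i < k\<close> over the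
  common scalar of \<open>e\<^sub>i e\<^sub>k\<close> isolates the quadratic expression in \<open>u\<close> and \<open>v\<close> on
  which the Manin relations act.
\<close>

lemma wedge_wedge:
  assumes "finite S"
  shows "wedge q (wedge q w u) v S =
    (\<Sum>(i,k) | i \<in> S \<and> k \<in> S \<and> i < k. (crossing q k S * crossing q i (S - {k})) *\<^sub>C
       (w (S - {i,k}) * (u i * v k + inverse (- q) *\<^sub>C (u k * v i))))"
proof -
  define g where "g i k = (crossing q i S * crossing q k (S - {i})) *\<^sub>C (w (S - {i,k}) * (u k * v i))" for i k
  have "wedge q (wedge q w u) v S = (\<Sum>i\<in>S. \<Sum>k\<in>S - {i}. g i k)"
    unfolding wedge_def g_def
    by (simp add: sum_distrib_right scaleC.scale_sum_right mult_scaleC_left scaleC_scaleC mult.assoc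
        Diff_insert2[symmetric] insert_commute)
  also have "\<dots> = (\<Sum>(i,k) | i \<in> S \<and> k \<in> S \<and> i < k. g i k + g k i)"
    by (rule sum_off_diagonal[OF assms])
  also have "\<dots> = (\<Sum>(i,k) | i \<in> S \<and> k \<in> S \<and> i < k. (crossing q k S * crossing q i (S - {k})) *\<^sub>C
       (w (S - {i,k}) * (u i * v k + inverse (- q) *\<^sub>C (u k * v i))))"
  proof (intro sum.cong refl, clarify)
    fix i k assume "i \<in> S" "k \<in> S" "i < k"
    then show "g i k + g k i = (crossing q k S * crossing q i (S - {k})) *\<^sub>C
       (w (S - {i,k}) * (u i * v k + inverse (- q) *\<^sub>C (u k * v i)))"
      unfolding g_def
      by (simp add: crossing_remove_greater[OF assms, of k i] crossing_remove_less distrib_left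
          mult_scaleC_right scaleC_scaleC scaleC_add_right insert_commute mult_ac add.commute
          del: inverse_minus_eq)
  qed
  finally show ?thesis .
qed

lemma wedge_infinite: "infinite S \<Longrightarrow> wedge q w v S = 0"
  by (simp add: wedge_def)

section \<open>Columns of a Manin matrix\<close>

text \<open>
  The relations are required for all natural indices, not just below a bound: a Manin matrix
  extended by zeros satisfies them, and no index ranges have to be carried along.
\<close>

locale q_Manin_array =
  fixes q :: complex and A :: "nat \<Rightarrow> nat \<Rightarrow> 'a::complex_algebra_1"
  assumes q_nonzero: "q \<noteq> 0"
    and same_column: "i < k \<Longrightarrow> A i j * A k j = inverse q *\<^sub>C (A k j * A i j)"
    and cross: "i < k \<Longrightarrow> j < l \<Longrightarrow> A i j * A k l - A k l * A i j =
          inverse q *\<^sub>C (A k j * A i l) - q *\<^sub>C (A i l * A k j)"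
begin

lemma wedge_column_twice: "wedge q (wedge q w (\<lambda>i. A i j)) (\<lambda>i. A i j) = (\<lambda>S. 0)"
proof
  fix S
  show "wedge q (wedge q w (\<lambda>i. A i j)) (\<lambda>i. A i j) S = 0"
  proof (cases "finite S")
    case True
    show ?thesis unfolding wedge_wedge[OF True]
      by (intro sum.neutral) (auto simp: same_column)
  qed (simp add: wedge_infinite)
qed

text \<open>
  The bracket in \<open>wedge_wedge\<close> for columns \<open>l, j\<close> against that for \<open>j, l\<close>:
  this is the cross relation multiplied by \<open>- q\<^sup>-\<^sup>1\<close>.
\<close>

lemma column_exchange:
  assumes "i < k" "j < l"
  shows "A i l * A k j + inverse (- q) *\<^sub>C (A k l * A i j) =
     inverse (- q) *\<^sub>C (A i j * A k l + inverse (- q) *\<^sub>C (A k j * A i l))"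
proof -
  have "A i j * A k l = A k l * A i j + (inverse q *\<^sub>C (A k j * A i l) - q *\<^sub>C (A i l * A k j))"
    using cross[OF assms] by (simp add: algebra_simps)
  then show ?thesis
    using q_nonzero by (simp add: scaleC_add_right scaleC.scale_right_diff_distrib scaleC_scaleC)
qed

lemma wedge_columns_exchange:
  assumes "j < l"
  shows "wedge q (wedge q w (\<lambda>i. A i l)) (\<lambda>i. A i j) =
    (\<lambda>S. inverse (- q) *\<^sub>C wedge q (wedge q w (\<lambda>i. A i j)) (\<lambda>i. A i l) S)"
proof
  fix S
  show "wedge q (wedge q w (\<lambda>i. A i l)) (\<lambda>i. A i j) S =
    inverse (- q) *\<^sub>C wedge q (wedge q w (\<lambda>i. A i j)) (\<lambda>i. A i l) S"
  proof (cases "finite S")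
    case True
    show ?thesis unfolding wedge_wedge[OF True] scaleC.scale_sum_right
      by (intro sum.cong refl, clarify)
        (simp only: column_exchange[OF _ assms] mult_scaleC_right scaleC_scaleC mult_ac)
  qed (simp add: wedge_infinite)
qed

lemma q_minor_insert_max:
  assumes "finite J" "\<forall>j\<in>J. j < l"
  shows "q_minor q A (insert l J) = wedge q (q_minor q A J) (\<lambda>i. A i l)"
proof -
  have "sorted_list_of_set (insert l J) = sorted_list_of_set J @ [l]"
    using assms by (subst sorted_list_of_set.sorted_key_list_of_set_insert)
      (auto intro!: sorted_insort_is_snoc simp: less_imp_le)
  then show ?thesis by (simp add: q_minor_def wedge_list_def)
qed

text \<open>
  Since columns obey the relations of the generators, sorting \<open>\<phi>\<^sub>J \<phi>\<^sub>l\<close> gives the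
  scalar that sorting \<open>e\<^sub>J e\<^sub>l\<close> gives. The induction removes the largest element \<open>m\<close>
  of \<open>J\<close>: if \<open>l < m\<close>, then \<open>\<phi>\<^sub>l\<close> is moved past \<open>\<phi>\<^sub>m\<close>, and otherwise it is already in place
  or a square.
\<close>

lemma wedge_q_minor:
  assumes "finite J"
  shows "wedge q (q_minor q A J) (\<lambda>i. A i l) =
    (if l \<in> J then (\<lambda>S. 0) else (\<lambda>S. crossing q l J *\<^sub>C q_minor q A (insert l J) S))"
  using assms
proof (induction J arbitrary: l rule: finite_linorder_max_induct)
  case empty
  then show ?case by (simp add: q_minor_insert_max crossing_def)
next
  case (insert m J)
  note [simp] = q_minor_insert_max[OF insert(1,2)]
  consider "l = m" | "l < m" | "m < l" by linarith
  then show ?case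
  proof cases
    case 1
    then show ?thesis by (simp add: wedge_column_twice)
  next
    case 2
    have J: "q_minor q A (insert m (insert l J)) = wedge q (q_minor q A (insert l J)) (\<lambda>i. A i m)"
      using insert 2 by (intro q_minor_insert_max) auto
    have "m \<notin> J" using insert(2) by blast
    then have "crossing q l (insert m J) = inverse (- q) * crossing q l J"
      using crossing_remove_greater[of "insert m J" m l q] insert(1) 2 by simp
    moreover have "wedge q (q_minor q A (insert m J)) (\<lambda>i. A i l) =
      (\<lambda>S. inverse (- q) *\<^sub>C wedge q (wedge q (q_minor q A J) (\<lambda>i. A i l)) (\<lambda>i. A i m) S)"
      unfolding q_minor_insert_max[OF insert(1,2)] by (rule wedge_columns_exchange[OF 2])
    moreover have "insert l (insert m J) = insert m (insert l J)" by (rule insert_commute)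
    moreover have "l \<noteq> m" using 2 by simp
    ultimately show ?thesis unfolding insert.IH
      by (cases "l \<in> J") (simp_all only: if_True if_False wedge_zero wedge_scaleC J scaleC_scaleC
          scaleC.scale_zero_right insert_iff simp_thms)
  next
    case 3
    have "q_minor q A (insert l (insert m J)) = wedge q (q_minor q A (insert m J)) (\<lambda>i. A i l)"
      using insert 3 by (intro q_minor_insert_max) auto
    moreover have "crossing q l (insert m J) = 1"
    proof -
      have "{s \<in> insert m J. l < s} = {}" using insert 3 by auto
      then show ?thesis by (simp only: crossing_def card.empty power_0)
    qed
    moreover have "l \<notin> insert m J" using insert 3 by auto
    ultimately show ?thesis by (simp add: scaleC_one)
  qed
qed

end

section \<open>The coefficient matrices of the q-adjugate\<close>

definition principal_sum :: "complex \<Rightarrow> (nat \<Rightarrow> nat \<Rightarrow> 'a::complex_algebra_1) \<Rightarrow> nat \<Rightarrow> nat \<Rightarrow> 'a" where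
  "principal_sum q A n m = (\<Sum>I | I \<subseteq> {0..<n} \<and> card I = m. q_minor q A I I)"

text \<open>
  The matrix \<open>Y\<^sup>(\<^sup>m\<^sup>)\<close>, with \<open>V = T \<union> {i}\<close>. Here \<open>inverse (crossing q i V)\<close> converts a coefficient
  of \<open>e\<^sub>V\<close> into one of \<open>e\<^sub>T e\<^sub>i\<close>, and \<open>crossing q k V\<close> comes from the multiplication by
  \<open>e\<^sub>k\<close>. For \<open>q = 1\<close> this is the coefficient of \<open>t\<close> to the power \<open>n - 1 - m\<close> in the classical
  adjugate of \<open>t + M\<close>.
\<close>

definition q_adjugate :: "complex \<Rightarrow> (nat \<Rightarrow> nat \<Rightarrow> 'a::complex_algebra_1) \<Rightarrow> nat \<Rightarrow> nat \<Rightarrow> nat \<Rightarrow> nat \<Rightarrow> 'a" where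
  "q_adjugate q A n m i k = (q powi (- sgn (int k - int i))) *\<^sub>C
     (\<Sum>V | V \<subseteq> {0..<n} \<and> card V = Suc m \<and> i \<in> V \<and> k \<in> V.
        (inverse (crossing q i V) * crossing q k V) *\<^sub>C q_minor q A (V - {i}) (V - {k}))"

lemma q_adjugate_zero:
  assumes "q \<noteq> 0" "i < n" "k < n"
  shows "q_adjugate q A n 0 i k = (if i = k then 1 else 0)"
proof (cases "i = k")
  case True
  have "{V. V \<subseteq> {0..<n} \<and> card V = Suc 0 \<and> i \<in> V} = {{i}}"
    using assms by (auto simp: card_Suc_eq)
  then show ?thesis using True assms
    by (simp add: q_adjugate_def crossing_nonzero q_minor_def wedge_list_def scaleC_one)
next
  case False
  then have "{V. V \<subseteq> {0..<n} \<and> card V = Suc 0 \<and> i \<in> V \<and> k \<in> V} = {}"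
    by (auto simp: card_Suc_eq)
  then show ?thesis using False by (simp only: q_adjugate_def sum.empty scaleC.scale_zero_right if_False)
qed

lemma q_adjugate_top: "q_adjugate q A n n i k = 0"
proof -
  have "\<not> (V \<subseteq> {0..<n} \<and> card V = Suc n)" for V
    using card_mono[of "{0..<n}" V] by auto
  then have "{V. V \<subseteq> {0..<n} \<and> card V = Suc n \<and> i \<in> V \<and> k \<in> V} = {}" by blast
  then show ?thesis by (simp only: q_adjugate_def sum.empty scaleC.scale_zero_right)
qed

context q_Manin_array
begin

text \<open>
  The power of \<open>q\<close> in \<open>q_mult\<close> cancels the one in \<open>q_adjugate\<close>. What is left is a sum
  over \<open>k\<close> that replaces \<open>e\<^sub>k\<close> by \<open>\<Sum>\<^sub>k e\<^sub>k A\<^sub>k\<^sub>l\<close>, that is, by the column \<open>\<phi>\<^sub>l\<close>.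
\<close>

lemma q_adjugate_times_column:
  "(\<Sum>k = 0..<n. (q powi sgn (int k - int i)) *\<^sub>C (q_adjugate q A n m i k * A k l)) =
   (\<Sum>U | U \<subseteq> {0..<n} \<and> card U = Suc m \<and> i \<in> U.
      inverse (crossing q i U) *\<^sub>C wedge q (q_minor q A (U - {i})) (\<lambda>k. A k l) U)"
proof -
  let ?P = "\<lambda>U. U \<subseteq> {0..<n} \<and> card U = Suc m \<and> i \<in> U"
  let ?t = "\<lambda>U k. inverse (crossing q i U) *\<^sub>C (crossing q k U *\<^sub>C (q_minor q A (U - {i}) (U - {k}) * A k l))"
  have fin: "finite {U. ?P U}" by (rule finite_subset[of _ "Pow {0..<n}"]) auto
  have "(\<Sum>k = 0..<n. (q powi sgn (int k - int i)) *\<^sub>C (q_adjugate q A n m i k * A k l)) =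
    (\<Sum>k\<in>{0..<n}. \<Sum>U | U \<in> {U. ?P U} \<and> k \<in> U. ?t U k)"
  proof (rule sum.cong[OF refl])
    fix k
    have "q powi sgn (int k - int i) * q powi (- sgn (int k - int i)) = 1"
      using q_nonzero by (simp add: power_int_minus)
    then show "(q powi sgn (int k - int i)) *\<^sub>C (q_adjugate q A n m i k * A k l) =
      (\<Sum>U | U \<in> {U. ?P U} \<and> k \<in> U. ?t U k)"
      by (simp add: q_adjugate_def mult_scaleC_left scaleC_scaleC scaleC_one sum_distrib_right conj_assoc)
  qed
  also have "\<dots> = (\<Sum>U\<in>{U. ?P U}. \<Sum>k | k \<in> {0..<n} \<and> k \<in> U. ?t U k)"
    by (rule sum.swap_restrict[OF _ fin]) simp
  also have "\<dots> = (\<Sum>U\<in>{U. ?P U}. inverse (crossing q i U) *\<^sub>C wedge q (q_minor q A (U - {i})) (\<lambda>k. A k l) U)"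
  proof (rule sum.cong[OF refl])
    fix U assume "U \<in> {U. ?P U}"
    then have "{k. k \<in> {0..<n} \<and> k \<in> U} = U" by auto
    then show "(\<Sum>k | k \<in> {0..<n} \<and> k \<in> U. ?t U k) =
       inverse (crossing q i U) *\<^sub>C wedge q (q_minor q A (U - {i})) (\<lambda>k. A k l) U"
      by (simp only: wedge_def scaleC.scale_sum_right)
  qed
  finally show ?thesis .
qed

text \<open>
  Dropping the larger of \<open>i, l\<close> from \<open>V\<close> takes a factor \<open>- q\<^sup>-\<^sup>1\<close> out of the crossing scalar
  of the smaller one, and the other scalar is unchanged. Which of the two is affected depends on the order of \<open>i\<close> and \<open>l\<close>, and this is the source of
  the exponent \<open>sgn\<close> in the \<open>q\<close>-product.
\<close>

lemma crossing_ratio: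
  assumes "finite V" "i \<in> V" "l \<in> V" "i \<noteq> l"
  shows "inverse (crossing q i (V - {l})) * crossing q l (V - {i}) =
    - (q powi (- sgn (int l - int i)) * (inverse (crossing q i V) * crossing q l V))"
proof (cases "i < l")
  case True
  then show ?thesis using q_nonzero crossing_remove_greater[OF assms(1,3) True]
    crossing_remove_less[OF True] crossing_nonzero[OF q_nonzero]
    by (simp add: power_int_minus field_simps)
next
  case False
  then have "l < i" using assms by simp
  then show ?thesis using q_nonzero crossing_remove_greater[OF assms(1,2) \<open>l < i\<close>]
    crossing_remove_less[OF \<open>l < i\<close>] crossing_nonzero[OF q_nonzero]
    by (simp add: power_int_minus field_simps)
qed

text \<open>
  On the diagonal, \<open>\<phi>\<close> over \<open>U - {i}\<close> times \<open>\<phi>\<^sub>i\<close> gives the principal minors on the sets that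
  contain \<open>i\<close>; the remaining principal minors form the next diagonal entry.
  Off the diagonal, the sets containing \<open>l\<close> contribute zero, and adding \<open>l\<close> to the others
  gives the sets that index the next matrix.
\<close>

lemma q_adjugate_step:
  assumes "i < n" "l < n"
  shows "(\<Sum>k = 0..<n. (q powi sgn (int k - int i)) *\<^sub>C (q_adjugate q A n m i k * A k l)) =
    (if i = l then principal_sum q A n (Suc m) else 0) - q_adjugate q A n (Suc m) i l"
proof (cases "i = l")
  case True
  let ?S = "{I. I \<subseteq> {0..<n} \<and> card I = Suc m}"
  have fin: "finite ?S" by (rule finite_subset[of _ "Pow {0..<n}"]) auto
  have "(\<Sum>U | U \<subseteq> {0..<n} \<and> card U = Suc m \<and> i \<in> U.
      inverse (crossing q i U) *\<^sub>C wedge q (q_minor q A (U - {i})) (\<lambda>k. A k l) U) =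
      (\<Sum>U\<in>{U \<in> ?S. i \<in> U}. q_minor q A U U)"
  proof (rule sum.cong)
    fix U assume "U \<in> {U \<in> ?S. i \<in> U}"
    then have "finite (U - {i})" "insert i U = U" by (auto intro: finite_subset)
    then show "inverse (crossing q i U) *\<^sub>C wedge q (q_minor q A (U - {i})) (\<lambda>k. A k l) U = q_minor q A U U"
      using True by (simp add: wedge_q_minor crossing_remove_self scaleC_scaleC scaleC_one
          crossing_nonzero q_nonzero)
  qed auto
  moreover have "q_adjugate q A n (Suc m) i l = (\<Sum>U\<in>{U \<in> ?S. i \<notin> U}. q_minor q A U U)"
  proof -
    have "(\<Sum>V | V \<subseteq> {0..<n} \<and> card V = Suc (Suc m) \<and> i \<in> V. q_minor q A (V - {i}) (V - {i})) =
      (\<Sum>U\<in>{U \<in> ?S. i \<notin> U}. q_minor q A U U)"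
      by (rule sum.reindex_bij_witness[of _ "insert i" "\<lambda>V. V - {i}"])
        (use assms in \<open>auto simp: insert_absorb card_insert_if finite_subset[of _ "{0..<n}"] card_Diff_singleton\<close>)
    then show ?thesis using True
      by (simp add: q_adjugate_def crossing_nonzero q_nonzero scaleC_one)
  qed
  moreover have "principal_sum q A n (Suc m) =
    (\<Sum>U\<in>{U \<in> ?S. i \<in> U}. q_minor q A U U) + (\<Sum>U\<in>{U \<in> ?S. i \<notin> U}. q_minor q A U U)"
    unfolding principal_sum_def
    by (subst sum.union_disjoint[symmetric]) (auto intro: sum.cong fin finite_subset[OF _ fin])
  ultimately show ?thesis using True by (simp add: q_adjugate_times_column)
next
  case False
  let ?t = "\<lambda>U. inverse (crossing q i U) *\<^sub>C wedge q (q_minor q A (U - {i})) (\<lambda>k. A k l) U"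
  let ?P = "{U. U \<subseteq> {0..<n} \<and> card U = Suc m \<and> i \<in> U}"
  have fin: "finite ?P" by (rule finite_subset[of _ "Pow {0..<n}"]) auto
  have "(\<Sum>U\<in>?P. ?t U) = (\<Sum>U\<in>{U \<in> ?P. l \<notin> U}. ?t U)"
  proof (rule sum.mono_neutral_right[OF fin])
    show "\<forall>U\<in>?P - {U \<in> ?P. l \<notin> U}. ?t U = 0"
    proof
      fix U assume "U \<in> ?P - {U \<in> ?P. l \<notin> U}"
      then have "finite (U - {i})" "l \<in> U - {i}" using False by (auto intro: finite_subset)
      then show "?t U = 0" by (simp add: wedge_q_minor)
    qed
  qed auto
  also have "\<dots> = (\<Sum>V | V \<subseteq> {0..<n} \<and> card V = Suc (Suc m) \<and> i \<in> V \<and> l \<in> V.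
     (inverse (crossing q i (V - {l})) * crossing q l (V - {i})) *\<^sub>C q_minor q A (V - {i}) (V - {l}))"
  proof (rule sum.reindex_bij_witness[of _ "\<lambda>V. V - {l}" "insert l"])
    fix U assume U: "U \<in> {U \<in> ?P. l \<notin> U}"
    then have "finite U" by (auto intro: finite_subset)
    moreover have "insert l U - {l} = U" "insert l (U - {i}) = insert l U - {i}"
      using U False by auto
    moreover have "crossing q l (insert l U - {i}) = crossing q l (U - {i})"
    proof -
      have "insert l U - {i} - {l} = U - {i}" using U by auto
      then show ?thesis using crossing_remove_self[of q l "insert l U - {i}"] by simp
    qed
    ultimately show "(inverse (crossing q i (insert l U - {l})) * crossing q l (insert l U - {i})) *\<^sub>C
      q_minor q A (insert l U - {i}) (insert l U - {l}) = ?t U"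
      using U by (simp add: wedge_q_minor scaleC_scaleC)
  qed (use assms False in \<open>auto simp: insert_absorb card_insert_if finite_subset[of _ "{0..<n}"] card_Diff_singleton\<close>)
  also have "\<dots> = - q_adjugate q A n (Suc m) i l"
    unfolding q_adjugate_def scaleC.scale_sum_right sum_negf[symmetric]
  proof (rule sum.cong[OF refl])
    fix V assume "V \<in> {V. V \<subseteq> {0..<n} \<and> card V = Suc (Suc m) \<and> i \<in> V \<and> l \<in> V}"
    then have "finite V" "i \<in> V" "l \<in> V" by (auto intro: finite_subset)
    then show "(inverse (crossing q i (V - {l})) * crossing q l (V - {i})) *\<^sub>C q_minor q A (V - {i}) (V - {l}) =
      - ((q powi (- sgn (int l - int i))) *\<^sub>C (inverse (crossing q i V) * crossing q l V) *\<^sub>C q_minor q A (V - {i}) (V - {l}))"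
      using crossing_ratio[of V i l] False
      by (simp add: scaleC_scaleC)
  qed
  finally show ?thesis using False by (simp add: q_adjugate_times_column)
qed

end

section \<open>Minors as q-determinants\<close>

lemma inversions_Suc:
  "inversions (Suc m) f = inversions m f + card {a. a < m \<and> f m < f a}"
proof -
  let ?P = "{(a, b). a < b \<and> b < m \<and> f b < f a}"
  let ?Q = "(\<lambda>a. (a, m)) ` {a. a < m \<and> f m < f a}"
  have "finite ?P"
    by (rule finite_subset[of _ "{..<m} \<times> {..<m}"]) auto
  moreover have "?P \<inter> ?Q = {}" by auto
  ultimately have "card (?P \<union> ?Q) = card ?P + card ?Q"
    by (intro card_Un_disjoint) simp_all
  moreover have "{(a, b). a < b \<and> b < Suc m \<and> f b < f a} = ?P \<union> ?Q"
    by (auto simp: less_Suc_eq)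
  moreover have "card ?Q = card {a. a < m \<and> f m < f a}"
    by (intro card_image inj_onI) simp
  ultimately show ?thesis by (simp only: inversions_def)
qed

lemma inversions_cong:
  "(\<And>a. a < m \<Longrightarrow> f a = g a) \<Longrightarrow> inversions m f = inversions m g"
  unfolding inversions_def by (rule arg_cong[of _ _ card]) auto

lemma inversions_snoc:
  assumes "distinct xs"
  shows "inversions (Suc (length xs)) ((!) (xs @ [x])) =
    inversions (length xs) ((!) xs) + card {s \<in> set xs. x < s}"
proof -
  have "{s \<in> set xs. x < s} = (!) xs ` {a. a < length xs \<and> x < xs ! a}"
    by (auto simp: in_set_conv_nth)
  moreover have "inj_on ((!) xs) {a. a < length xs \<and> x < xs ! a}"
    using assms by (auto simp: inj_on_def nth_eq_iff_index_eq)
  ultimately have "card {s \<in> set xs. x < s} = card {a. a < length xs \<and> x < xs ! a}"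
    by (simp add: card_image)
  moreover have "{a. a < length xs \<and> (xs @ [x]) ! length xs < (xs @ [x]) ! a} = {a. a < length xs \<and> x < xs ! a}"
    by (auto simp: nth_append)
  ultimately show ?thesis
    by (simp add: inversions_Suc nth_append cong: inversions_cong)
qed

text \<open>
  Choosing the summand \<open>e\<^sub>x A\<^sub>x\<^sub>j\<close> from every column gives a list \<open>xs\<close> of rows without
  repetition. The crossing scalar of a newly appended row counts the inversions that it adds to
  the list.
\<close>

lemma wedge_list_expansion:
  assumes "finite S"
  shows "wedge_list q A js S = (\<Sum>xs | distinct xs \<and> set xs = S \<and> length xs = length js.
     inverse (- q) ^ inversions (length xs) ((!) xs) *\<^sub>C prod_list (map2 A xs js))"
  using assms
proof (induction js arbitrary: S rule: rev_induct)
  case Nil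
  have "{xs. distinct xs \<and> set xs = S \<and> length xs = length []} = (if S = {} then {[]} else {})" by auto
  then show ?case by (simp add: wedge_list_def inversions_def scaleC_one)
next
  case (snoc j js)
  let ?X = "\<lambda>S. {xs. distinct xs \<and> set xs = S \<and> length xs = length js}"
  let ?t = "\<lambda>js xs. inverse (- q) ^ inversions (length xs) ((!) xs) *\<^sub>C prod_list (map2 A xs js)"
  have fin: "finite (?X T)" if "finite T" for T
    by (rule finite_subset[OF _ finite_lists_length_eq[OF that, of "length js"]]) auto
  have "wedge_list q A (js @ [j]) S = (\<Sum>i\<in>S. crossing q i S *\<^sub>C (wedge_list q A js (S - {i}) * A i j))"
    by (simp add: wedge_list_def wedge_def)
  also have "\<dots> = (\<Sum>i\<in>S. \<Sum>xs\<in>?X (S - {i}). crossing q i S *\<^sub>C (?t js xs * A i j))"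
    using snoc by (simp add: sum_distrib_right scaleC.scale_sum_right)
  also have "\<dots> = (\<Sum>(i,xs)\<in>Sigma S (\<lambda>i. ?X (S - {i})). crossing q i S *\<^sub>C (?t js xs * A i j))"
    using snoc.prems fin by (intro sum.Sigma) auto
  also have "\<dots> = (\<Sum>xs | distinct xs \<and> set xs = S \<and> length xs = length (js @ [j]). ?t (js @ [j]) xs)"
  proof (rule sum.reindex_bij_witness[of _ "\<lambda>xs. (last xs, butlast xs)" "\<lambda>(i,xs). xs @ [i]"])
    fix p assume "p \<in> Sigma S (\<lambda>i. ?X (S - {i}))"
    then obtain i xs where p: "p = (i, xs)" "i \<in> S" "distinct xs" "set xs = S - {i}" "length xs = length js"
      by auto
    show "(case p of (i, xs) \<Rightarrow> xs @ [i]) \<in> {xs. distinct xs \<and> set xs = S \<and> length xs = length (js @ [j])}"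
      using p by auto
    show "(\<lambda>xs. (last xs, butlast xs)) (case p of (i, xs) \<Rightarrow> xs @ [i]) = p"
      using p(1) by simp
    have "crossing q i S = inverse (- q) ^ card {s \<in> set xs. i < s}"
      using p by (simp add: crossing_remove_self[symmetric, of q i S]) (simp add: crossing_def)
    then show "?t (js @ [j]) (case p of (i, xs) \<Rightarrow> xs @ [i]) = (case p of (i, xs) \<Rightarrow> crossing q i S *\<^sub>C (?t js xs * A i j))"
      using p(1,5) inversions_snoc[OF p(3), of i] by (simp add: mult_scaleC_left scaleC_scaleC power_add mult.commute)
  next
    fix xs assume "xs \<in> {xs. distinct xs \<and> set xs = S \<and> length xs = length (js @ [j])}"
    then obtain ys y where xs: "xs = ys @ [y]" "distinct xs" "set xs = S" "length xs = Suc (length js)"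
      by (cases xs rule: rev_cases) auto
    then show "(last xs, butlast xs) \<in> Sigma S (\<lambda>i. ?X (S - {i}))"
      by auto
    show "(case (last xs, butlast xs) of (i, xs) \<Rightarrow> xs @ [i]) = xs" using xs by simp
  qed
  finally show ?case .
qed

text \<open>
  A permutation \<open>\<tau>\<close> of the positions corresponds to the list of rows
  \<open>pick I (\<tau> 0), pick I (\<tau> 1), \<dots>\<close>; inversions agree because \<open>pick I\<close> is
  strictly increasing.
\<close>

lemma q_det_submatrix:
  assumes M: "M \<in> carrier_mat n n" and I: "I \<subseteq> {0..<n}"
    and A: "\<And>i j. i < n \<Longrightarrow> j < n \<Longrightarrow> A i j = M $$ (i,j)"
  shows "q_det q (submatrix M I I) = q_minor q A I I"
proof -
  define m where "m = card I"
  have fin: "finite I" using I by (auto intro: finite_subset)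
  have rows: "{i. i < n \<and> i \<in> I} = I" using I by auto
  have dims: "dim_row (submatrix M I I) = m"
    using M rows by (simp add: dim_submatrix m_def)
  have pick_I: "pick I a \<in> I" "pick I a < n" if "a < m" for a
    using pick_in_set_le[of a I] that I by (auto simp: m_def)
  have pick_less: "pick I a < pick I b \<longleftrightarrow> a < b" if "a < m" "b < m" for a b
    using that by (metis linorder_neqE_nat m_def not_less_iff_gr_or_eq pick_mono_le)
  have pick_inj: "inj_on (pick I) {0..<m}"
    by (rule linorder_inj_onI') (metis atLeastLessThan_iff less_irrefl pick_less)
  have pick_img: "pick I ` {0..<m} = I"
    by (rule card_subset_eq[OF fin]) (use pick_I pick_inj in \<open>auto simp: card_image m_def\<close>)
  have sl: "sorted_list_of_set I = map (pick I) [0..<m]"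
    by (subst sorted_list_of_set_unique[OF fin, symmetric])
      (use pick_less pick_img in \<open>auto simp: sorted_wrt_iff_nth_less m_def\<close>)
  define code where "code \<tau> = map (\<lambda>a. pick I (\<tau> a)) [0..<m]" for \<tau>
  define decode where
    "decode xs a = (if a < m then inv_into {0..<m} (pick I) (xs ! a) else a)" for xs a
  let ?X = "{xs. distinct xs \<and> set xs = I \<and> length xs = m}"
  have pick_bij: "bij_betw (pick I) {0..<m} I"
    using pick_inj pick_img by (simp add: bij_betw_def)
  have entry: "submatrix M I I $$ (a, b) = A (pick I a) (pick I b)" if "a < m" "b < m" for a b
    using that M rows pick_I by (simp add: submatrix_index m_def A)
  have "q_det q (submatrix M I I) = (\<Sum>xs\<in>?X.
     inverse (- q) ^ inversions m ((!) xs) *\<^sub>C prod_list (map2 A xs (map (pick I) [0..<m])))"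
    unfolding q_det_def dims
  proof (rule sum.reindex_bij_witness[of _ decode code])
    fix \<tau> assume "\<tau> \<in> {\<tau>. \<tau> permutes {0..<m}}"
    then have \<tau>: "\<tau> permutes {0..<m}" by simp
    then have \<tau>_less: "\<tau> a < m" if "a < m" for a
      using permutes_in_image[OF \<tau>, of a] that by simp
    have "bij_betw (pick I \<circ> \<tau>) {0..<m} I"
      using bij_betw_trans[OF permutes_imp_bij[OF \<tau>] pick_bij] .
    then have "inj_on (\<lambda>a. pick I (\<tau> a)) {0..<m}" "(\<lambda>a. pick I (\<tau> a)) ` {0..<m} = I"
      by (auto simp: bij_betw_def comp_def)
    then show "code \<tau> \<in> ?X" by (simp add: code_def distinct_map)
    show "decode (code \<tau>) = \<tau>"
      using \<tau> \<tau>_less pick_inj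
      by (auto simp: fun_eq_iff decode_def code_def permutes_not_in inv_into_f_f)
    have "inversions m ((!) (code \<tau>)) = inversions m \<tau>"
      unfolding inversions_def
      by (rule arg_cong[of _ _ card]) (auto simp: code_def pick_less \<tau>_less)
    moreover have "map2 A (code \<tau>) (map (pick I) [0..<m]) =
        map (\<lambda>j. submatrix M I I $$ (\<tau> j, j)) [0..<m]"
      by (rule nth_equalityI) (auto simp: code_def entry \<tau>_less)
    ultimately show "inverse (- q) ^ inversions m ((!) (code \<tau>)) *\<^sub>C
        prod_list (map2 A (code \<tau>) (map (pick I) [0..<m])) =
      ((- q) powi (- int (inversions m \<tau>))) *\<^sub>C
        prod_list (map (\<lambda>j. submatrix M I I $$ (\<tau> j, j)) [0..<m])"
      by (simp add: power_int_minus power_inverse del: inverse_minus_eq)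
  next
    fix xs assume "xs \<in> ?X"
    then have xs: "distinct xs" "set xs = I" "length xs = m" by auto
    have "bij_betw ((!) xs) {0..<m} I"
      using bij_betw_nth[of xs "{0..<m}" I] xs by (simp add: atLeast0LessThan)
    then have "bij_betw (inv_into {0..<m} (pick I) \<circ> (!) xs) {0..<m} {0..<m}"
      using bij_betw_inv_into[OF pick_bij] by (rule bij_betw_trans)
    then have "bij_betw (decode xs) {0..<m} {0..<m}"
      by (rule bij_betw_cong[THEN iffD1, rotated]) (simp add: decode_def)
    then show "decode xs \<in> {\<tau>. \<tau> permutes {0..<m}}"
      by (auto intro: bij_imp_permutes simp: decode_def)
    have "pick I (inv_into {0..<m} (pick I) (xs ! a)) = xs ! a" if "a < m" for a
      using that xs nth_mem[of a xs] pick_img by (intro f_inv_into_f) simp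
    then show "code (decode xs) = xs"
      using xs by (intro nth_equalityI) (auto simp: code_def decode_def)
  qed
  also have "\<dots> = q_minor q A I I"
    unfolding q_minor_def wedge_list_expansion[OF fin] sl by (intro sum.cong) auto
  finally show ?thesis .
qed

lemma q_minor_sum_eq_principal_sum:
  assumes M: "M \<in> carrier_mat n n"
    and A: "\<And>i j. i < n \<Longrightarrow> j < n \<Longrightarrow> A i j = M $$ (i,j)"
  shows "q_minor_sum q M m = principal_sum q A n m"
proof (cases "m = 0")
  case True
  have "{I. I \<subseteq> {0..<n} \<and> card I = 0} = {{}}" by (auto simp: finite_subset)
  then show ?thesis using True
    by (simp add: q_minor_sum_def principal_sum_def q_minor_def wedge_list_def)
next
  case False
  then show ?thesis using M
    by (auto simp: q_minor_sum_def principal_sum_def q_det_submatrix[OF M _ A] intro!: sum.cong)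
qed

section \<open>The Cayley-Hamilton theorem\<close>

lemma q_pow_carrier:
  assumes "M \<in> carrier_mat n n"
  shows "q_pow q M m \<in> carrier_mat n n"
  using assms by (induction m) (auto simp: q_mult_def)

theorem theorem5p6:
  fixes q :: complex and n :: nat and M :: "'a::complex_algebra_1 mat"
  assumes "q \<noteq> 0"
    and "M \<in> carrier_mat n n"
    and "q_Manin q M"
  shows "mat_sum n (\<lambda>m. ((-1) ^ m * q_minor_sum q M m) \<cdot>\<^sub>m q_pow q M (n - m)) {0..n} = 0\<^sub>m n n"
proof -
  define A where "A i j = (if i < n \<and> j < n then M $$ (i,j) else 0)" for i j
  have A: "A i j = M $$ (i,j)" if "i < n" "j < n" for i j using that by (simp add: A_def)
  interpret q_Manin_array q A
  proof
    show "q \<noteq> 0" by fact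
    fix i k j :: nat assume "i < k"
    then show "A i j * A k j = inverse q *\<^sub>C (A k j * A i j)"
      using assms(2,3) by (auto simp: A_def q_Manin_def)
  next
    fix i k j l :: nat assume "i < k" "j < l"
    then show "A i j * A k l - A k l * A i j = inverse q *\<^sub>C (A k j * A i l) - q *\<^sub>C (A i l * A k j)"
      using assms(2,3) by (auto simp: A_def q_Manin_def)
  qed
  \<comment> \<open>Left multiplication by the \<open>\<e>\<^sub>j\<close> commutes with right \<open>q\<close>-multiplication by \<open>M\<close>, so the
    recursion for the adjugates can be summed up.\<close>
  have partial: "(\<Sum>j\<le>m. (-1) ^ j * q_minor_sum q M j * q_pow q M (m - j) $$ (i,k)) =
      (-1) ^ m * q_adjugate q A n m i k" if "i < n" "k < n" for m i k
    using that
  proof (induction m arbitrary: i k)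
    case 0
    then show ?case using assms(1,2) by (simp add: q_adjugate_zero q_minor_sum_def)
  next
    case (Suc m)
    let ?c = "\<lambda>j. (-1) ^ j * q_minor_sum q M j"
    let ?s = "\<lambda>r. q powi sgn (int r - int i)"
    have pow: "q_pow q M (Suc a) $$ (i,k) = (\<Sum>r = 0..<n. ?s r *\<^sub>C (q_pow q M a $$ (i,r) * A r k))" for a
      using Suc.prems assms(2) q_pow_carrier[OF assms(2), of q a] by (auto simp: q_mult_def A intro!: sum.cong)
    have "(\<Sum>j\<le>m. ?c j * q_pow q M (Suc m - j) $$ (i,k)) =
      (\<Sum>j\<le>m. \<Sum>r = 0..<n. ?s r *\<^sub>C (?c j * q_pow q M (m - j) $$ (i,r) * A r k))"
      by (intro sum.cong refl) (simp add: Suc_diff_le pow sum_distrib_left mult_scaleC_right mult.assoc del: q_pow.simps)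
    also have "\<dots> = (\<Sum>r = 0..<n. ?s r *\<^sub>C ((\<Sum>j\<le>m. ?c j * q_pow q M (m - j) $$ (i,r)) * A r k))"
      by (subst sum.swap) (simp add: sum_distrib_right scaleC.scale_sum_right)
    also have "\<dots> = (-1) ^ m * (\<Sum>r = 0..<n. ?s r *\<^sub>C (q_adjugate q A n m i r * A r k))"
      using Suc by (simp add: sum_distrib_left mult_scaleC_right mult.assoc)
    also have "\<dots> = (-1) ^ m * ((if i = k then q_minor_sum q M (Suc m) else 0) - q_adjugate q A n (Suc m) i k)"
      using Suc.prems by (simp add: q_adjugate_step q_minor_sum_eq_principal_sum[OF assms(2) A])
    finally show ?case using Suc.prems assms(2)
      by (simp add: algebra_simps)
  qed
  show ?thesis
  proof (rule eq_matI)
    fix i k assume "i < dim_row (0\<^sub>m n n :: 'a mat)" "k < dim_col (0\<^sub>m n n :: 'a mat)"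
    then show "mat_sum n (\<lambda>m. ((-1) ^ m * q_minor_sum q M m) \<cdot>\<^sub>m q_pow q M (n - m)) {0..n} $$ (i,k) = 0\<^sub>m n n $$ (i,k)"
      using partial[of i k n] carrier_matD[OF q_pow_carrier[OF assms(2)]]
      by (simp add: mat_sum_def q_adjugate_top atLeast0AtMost)
  qed (simp_all add: mat_sum_def)
qed

end
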